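(* Hyper Hoare Logic is sound: for all hyper-assertions $P,Q$ and every command $C$, if $\vdash \{P\}\,C\,\{Q\}$ then $\models \{P\}\,C\,\{Q\}$.
   Context: Fix sets $\mathit{PVars}$ (program variables), $\mathit{PVals}$ (program values), $\mathit{LVars}$ (logical variables), $\mathit{LVals}$ (logical values). Program states are total functions $\sigma:\mathit{PVars}\to\mathit{PVals}$. Commands are given by $C ::= \mathbf{skip} \mid x:=e \mid x:=\mathrm{nonDet}() \mid \mathbf{assume}\ b \mid C;C \mid C+C \mid C^{*}$, where $x\in\mathit{PVars}$, expressions $e$ are total functions from program states to $\mathit{PVals}$, and $b$ are total functions from program states to Booleans. The big-step relation $\langle C,\sigma\rangle\to\sigma'$ is defined inductively: $\langle\mathbf{skip},\sigma\rangle\to\sigma$; $\langle x:=e,\sigma\rangle\to\sigma[x\mapsto e(\sigma)]$; $\langle x:=\mathrm{nonDet}(),\sigma\rangle\to\sigma[x\mapsto v]$ for every $v$; $\langle \mathbf{assume}\ b,\sigma\rangle\to\sigma$ if $b(\sigma)$; $\langle C_1;C_2,\sigma\rangle\to\sigma''$ if $\langle C_1,\sigma\rangle\to\sigma'$ and $\langle C_2,\sigma'\rangle\to\sigma''$; $\langle C_1+C_2,\sigma\rangle\to\sigma'$ if $\langle C_1,\sigma\rangle\to\sigma'$ or $\langle C_2,\sigma\rangle\to\sigma'$; $\langle C^*,\sigma\rangle\to\sigma$; and $\langle C^*,\sigma\rangle\to\sigma''$ if $\langle C,\sigma\rangle\to\sigma'$ and $\langle C^*,\sigma'\rangle\to\sigma''$.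 An extended state is a pair $\varphi=(\varphi^L,\varphi^P)$ of a logical state $\varphi^L:\mathit{LVars}\to\mathit{LVals}$ and a program state $\varphi^P$. For a set $S$ of extended states, $\mathit{sem}(C,S)=\{\varphi\mid \exists\sigma.\ (\varphi^L,\sigma)\in S\wedge \langle C,\sigma\rangle\to\varphi^P\}$. A hyper-assertion is a total function from sets of extended states to Booleans; $P\models Q$ means $\forall S.\ P(S)\Rightarrow Q(S)$. Validity: $\models\{P\}C\{Q\}$ iff for all sets $S$ of extended states, $P(S)$ implies $Q(\mathit{sem}(C,S))$. Define $(Q_1\otimes Q_2)(S)$ iff $\exists S_1,S_2.\ S=S_1\cup S_2\wedge Q_1(S_1)\wedge Q_2(S_2)$, and for a family $(I_n)_{n\in\mathbb N}$, $(\bigotimes_{n\in\mathbb N} I_n)(S)$ iff there is $f:\mathbb N\to$ sets of extended states with $S=\bigcup_n f(n)$ and $I_n(f(n))$ for all $n$. Derivability $\vdash\{P\}C\{Q\}$ is the least relation closed under the rules: (Skip) $\vdash\{P\}\mathbf{skip}\{P\}$; (Seq) from $\vdash\{P\}C_1\{R\}$ and $\vdash\{R\}C_2\{Q\}$ infer $\vdash\{P\}C_1;C_2\{Q\}$; (Choice) from $\vdash\{P\}C_1\{Q_1\}$ and $\vdash\{P\}C_2\{Q_2\}$ infer $\vdash\{P\}C_1+C_2\{Q_1\otimes Q_2\}$; (Cons) from $P\models P'$, $Q'\models Q$ and $\vdash\{P'\}C\{Q'\}$ infer $\vdash\{P\}C\{Q\}$; (Assume) $\vdash\{\lambda S.\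 P(\{\varphi\in S\mid b(\varphi^P)\})\}\,\mathbf{assume}\ b\,\{P\}$; (Exist) from $\vdash\{P(x)\}C\{Q(x)\}$ for all $x$ (of an arbitrary type) infer $\vdash\{\lambda S.\exists x.P(x)(S)\}C\{\lambda S.\exists x.Q(x)(S)\}$; (Assign) $\vdash\{\lambda S.\ P(\{\varphi\mid\exists\alpha\in S.\ \varphi^L=\alpha^L\wedge\varphi^P=\alpha^P[x\mapsto e(\alpha^P)]\})\}\,x:=e\,\{P\}$; (Iter) from $\vdash\{I_n\}C\{I_{n+1}\}$ for all $n\in\mathbb N$ infer $\vdash\{I_0\}C^*\{\bigotimes_{n\in\mathbb N}I_n\}$; (Havoc) $\vdash\{\lambda S.\ P(\{\varphi\mid\exists\alpha\in S.\exists v.\ \varphi^L=\alpha^L\wedge\varphi^P=\alpha^P[x\mapsto v]\})\}\,x:=\mathrm{nonDet}()\,\{P\}$. *)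

theory Defs
  imports Main
begin

section \<open>Commands and big-step semantics\<close>

type_synonym ('pvar, 'pval) pstate = "'pvar \<Rightarrow> 'pval"

datatype ('pvar, 'pval) cmd =
    Skip
  | Assign 'pvar "('pvar, 'pval) pstate \<Rightarrow> 'pval"
  | Havoc 'pvar
  | Assume "('pvar, 'pval) pstate \<Rightarrow> bool"
  | Seq "('pvar, 'pval) cmd" "('pvar, 'pval) cmd"
  | Choice "('pvar, 'pval) cmd" "('pvar, 'pval) cmd"
  | Star "('pvar, 'pval) cmd"

inductive big_step ::
  "('pvar, 'pval) cmd \<Rightarrow> ('pvar, 'pval) pstate \<Rightarrow> ('pvar, 'pval) pstate \<Rightarrow> bool"
  (\<open>\<langle>_, _\<rangle> \<rightarrow> _\<close> [0, 0, 51] 50)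
where
  Skip: "\<langle>Skip, \<sigma>\<rangle> \<rightarrow> \<sigma>"
| Assign: "\<langle>Assign x e, \<sigma>\<rangle> \<rightarrow> \<sigma>(x := e \<sigma>)"
| Havoc: "\<langle>Havoc x, \<sigma>\<rangle> \<rightarrow> \<sigma>(x := v)"
| Assume: "b \<sigma> \<Longrightarrow> \<langle>Assume b, \<sigma>\<rangle> \<rightarrow> \<sigma>"
| Seq: "\<langle>C1, \<sigma>\<rangle> \<rightarrow> \<sigma>' \<Longrightarrow> \<langle>C2, \<sigma>'\<rangle> \<rightarrow> \<sigma>'' \<Longrightarrow> \<langle>Seq C1 C2, \<sigma>\<rangle> \<rightarrow> \<sigma>''"
| Choice1: "\<langle>C1, \<sigma>\<rangle> \<rightarrow> \<sigma>' \<Longrightarrow> \<langle>Choice C1 C2, \<sigma>\<rangle> \<rightarrow> \<sigma>'"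
| Choice2: "\<langle>C2, \<sigma>\<rangle> \<rightarrow> \<sigma>' \<Longrightarrow> \<langle>Choice C1 C2, \<sigma>\<rangle> \<rightarrow> \<sigma>'"
| Star_refl: "\<langle>Star C, \<sigma>\<rangle> \<rightarrow> \<sigma>"
| Star_step: "\<langle>C, \<sigma>\<rangle> \<rightarrow> \<sigma>' \<Longrightarrow> \<langle>Star C, \<sigma>'\<rangle> \<rightarrow> \<sigma>'' \<Longrightarrow> \<langle>Star C, \<sigma>\<rangle> \<rightarrow> \<sigma>''"

section \<open>Extended states and hyper-assertions\<close>

text \<open>The first component of an extended state is its logical state, the second its program state.\<close>

type_synonym ('lvar, 'lval, 'pvar, 'pval) estate =
  "('lvar \<Rightarrow> 'lval) \<times> ('pvar, 'pval) pstate"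

type_synonym ('lvar, 'lval, 'pvar, 'pval) hassn =
  "('lvar, 'lval, 'pvar, 'pval) estate set \<Rightarrow> bool"

definition sem ::
  "('pvar, 'pval) cmd \<Rightarrow> ('lvar, 'lval, 'pvar, 'pval) estate set
    \<Rightarrow> ('lvar, 'lval, 'pvar, 'pval) estate set" where
  "sem C S = {\<phi>. \<exists>\<sigma>. (fst \<phi>, \<sigma>) \<in> S \<and> \<langle>C, \<sigma>\<rangle> \<rightarrow> snd \<phi>}"

definition entails ::
  "('lvar, 'lval, 'pvar, 'pval) hassn \<Rightarrow> ('lvar, 'lval, 'pvar, 'pval) hassn \<Rightarrow> bool" where
  "entails P Q \<longleftrightarrow> (\<forall>S. P S \<longrightarrow> Q S)"

definition hyper_valid ::
  "('lvar, 'lval, 'pvar, 'pval) hassn \<Rightarrow> ('pvar, 'pval) cmd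
    \<Rightarrow> ('lvar, 'lval, 'pvar, 'pval) hassn \<Rightarrow> bool"
  (\<open>\<Turnstile> {_} _ {_}\<close> [0, 0, 0] 50) where
  "\<Turnstile> {P} C {Q} \<longleftrightarrow> (\<forall>S. P S \<longrightarrow> Q (sem C S))"

definition otimes ::
  "('lvar, 'lval, 'pvar, 'pval) hassn \<Rightarrow> ('lvar, 'lval, 'pvar, 'pval) hassn
    \<Rightarrow> ('lvar, 'lval, 'pvar, 'pval) hassn" where
  "otimes Q1 Q2 = (\<lambda>S. \<exists>S1 S2. S = S1 \<union> S2 \<and> Q1 S1 \<and> Q2 S2)"

definition Otimes ::
  "(nat \<Rightarrow> ('lvar, 'lval, 'pvar, 'pval) hassn) \<Rightarrow> ('lvar, 'lval, 'pvar, 'pval) hassn" where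
  "Otimes I = (\<lambda>S. \<exists>f. S = (\<Union>n. f n) \<and> (\<forall>n. I n (f n)))"

section \<open>Derivability\<close>

text \<open>
  The rule \<open>Exist\<close> is meant for families indexed by an arbitrary type, but an inductive definition
  cannot quantify over types. A family of pairs of hyper-assertions may be reindexed by its own
  range, so it is enough to take as indices an arbitrary set of pairs of hyper-assertions. Lemma
  \<open>hyper_derivable_Exist\<close> below recovers the rule for index sets of any type.
\<close>

inductive hyper_derivable ::
  "('lvar, 'lval, 'pvar, 'pval) hassn \<Rightarrow> ('pvar, 'pval) cmd
    \<Rightarrow> ('lvar, 'lval, 'pvar, 'pval) hassn \<Rightarrow> bool"
  (\<open>\<turnstile> {_} _ {_}\<close> [0, 0, 0] 50)
where
  Skip: "\<turnstile> {P} Skip {P}"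
| Seq: "\<turnstile> {P} C1 {R} \<Longrightarrow> \<turnstile> {R} C2 {Q} \<Longrightarrow> \<turnstile> {P} Seq C1 C2 {Q}"
| Choice: "\<turnstile> {P} C1 {Q1} \<Longrightarrow> \<turnstile> {P} C2 {Q2} \<Longrightarrow> \<turnstile> {P} Choice C1 C2 {otimes Q1 Q2}"
| Cons: "entails P P' \<Longrightarrow> entails Q' Q \<Longrightarrow> \<turnstile> {P'} C {Q'} \<Longrightarrow> \<turnstile> {P} C {Q}"
| Assume: "\<turnstile> {\<lambda>S. P {\<phi> \<in> S. b (snd \<phi>)}} Assume b {P}"
| Exist: "(\<And>x :: ('lvar, 'lval, 'pvar, 'pval) hassn \<times> ('lvar, 'lval, 'pvar, 'pval) hassn.
        x \<in> X \<Longrightarrow> \<turnstile> {P x} C {Q x})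
    \<Longrightarrow> \<turnstile> {\<lambda>S. \<exists>x\<in>X. P x S} C {\<lambda>S. \<exists>x\<in>X. Q x S}"
| Assign: "\<turnstile> {\<lambda>S. P {\<phi>. \<exists>\<alpha>\<in>S. fst \<phi> = fst \<alpha> \<and> snd \<phi> = (snd \<alpha>)(x := e (snd \<alpha>))}}
    Assign x e {P}"
| Iter: "(\<And>n. \<turnstile> {I n} C {I (Suc n)}) \<Longrightarrow> \<turnstile> {I 0} Star C {Otimes I}"
| Havoc: "\<turnstile> {\<lambda>S. P {\<phi>. \<exists>\<alpha>\<in>S. \<exists>v. fst \<phi> = fst \<alpha> \<and> snd \<phi> = (snd \<alpha>)(x := v)}}
    Havoc x {P}"

lemma hyper_derivable_Exist:
  fixes P Q :: "'i \<Rightarrow> ('lvar, 'lval, 'pvar, 'pval) hassn" and X :: "'i set"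
  assumes "\<And>x. x \<in> X \<Longrightarrow> \<turnstile> {P x} C {Q x}"
  shows "\<turnstile> {\<lambda>S. \<exists>x\<in>X. P x S} C {\<lambda>S. \<exists>x\<in>X. Q x S}"
proof -
  have "\<turnstile> {\<lambda>S. \<exists>y\<in>(\<lambda>x. (P x, Q x)) ` X. fst y S} C {\<lambda>S. \<exists>y\<in>(\<lambda>x. (P x, Q x)) ` X. snd y S}"
    by (rule hyper_derivable.Exist) (auto intro: assms)
  then show ?thesis by simp
qed

corollary hyper_derivable_Exist_type:
  fixes P Q :: "'i \<Rightarrow> ('lvar, 'lval, 'pvar, 'pval) hassn"
  assumes "\<And>x. \<turnstile> {P x} C {Q x}"
  shows "\<turnstile> {\<lambda>S. \<exists>x. P x S} C {\<lambda>S. \<exists>x. Q x S}"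
  using hyper_derivable_Exist[of UNIV P C Q] assms by simp

end

theory Submission
  imports Defs
begin

\<comment> \<open>Soundness is by induction on the derivation, once \<open>sem\<close> is computed
  compositionally. For sequencing it composes, for choice it is a union, and for
  \<open>Star C\<close> it is the union of all iterates of \<open>sem C\<close>. These unions are
  exactly what \<open>otimes\<close> and \<open>Otimes\<close> ask to be split, with the images and
  the iterates as witnesses.\<close>
inductive_simps big_step_Skip_iff: "\<langle>Skip, \<sigma>\<rangle> \<rightarrow> \<sigma>'"
inductive_simps big_step_Assign_iff: "\<langle>Assign x e, \<sigma>\<rangle> \<rightarrow> \<sigma>'"
inductive_simps big_step_Havoc_iff: "\<langle>Havoc x, \<sigma>\<rangle> \<rightarrow> \<sigma>'"
inductive_simps big_step_Assume_iff: "\<langle>Assume b, \<sigma>\<rangle> \<rightarrow> \<sigma>'"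
inductive_simps big_step_Seq_iff: "\<langle>Seq C1 C2, \<sigma>\<rangle> \<rightarrow> \<sigma>'"
inductive_simps big_step_Choice_iff: "\<langle>Choice C1 C2, \<sigma>\<rangle> \<rightarrow> \<sigma>'"

lemma sem_Skip: "sem Skip S = S"
  by (auto simp: sem_def big_step_Skip_iff)

lemma sem_Assign:
  "sem (Assign x e) S = {\<phi>. \<exists>\<alpha>\<in>S. fst \<phi> = fst \<alpha> \<and> snd \<phi> = (snd \<alpha>)(x := e (snd \<alpha>))}"
  by (force simp: sem_def big_step_Assign_iff)

lemma sem_Havoc:
  "sem (Havoc x) S = {\<phi>. \<exists>\<alpha>\<in>S. \<exists>v. fst \<phi> = fst \<alpha> \<and> snd \<phi> = (snd \<alpha>)(x := v)}"
  by (force simp: sem_def big_step_Havoc_iff)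

lemma sem_Assume: "sem (Assume b) S = {\<phi> \<in> S. b (snd \<phi>)}"
  by (auto simp: sem_def big_step_Assume_iff)

lemma sem_Seq: "sem (Seq C1 C2) S = sem C2 (sem C1 S)"
  by (auto simp: sem_def big_step_Seq_iff)

lemma sem_Choice: "sem (Choice C1 C2) S = sem C1 S \<union> sem C2 S"
  by (auto simp: sem_def big_step_Choice_iff)

text \<open>Makes the number of iterations explicit, since the rule \<open>Iter\<close> indexes its
  invariants by it.\<close>

lemma big_step_Star_iff_relpowp: "\<langle>Star C, \<sigma>\<rangle> \<rightarrow> \<sigma>' \<longleftrightarrow> (\<exists>n. (big_step C ^^ n) \<sigma> \<sigma>')"
proof
  assume "\<langle>Star C, \<sigma>\<rangle> \<rightarrow> \<sigma>'"
  then show "\<exists>n. (big_step C ^^ n) \<sigma> \<sigma>'"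
  proof (induction "Star C" \<sigma> \<sigma>' rule: big_step.induct)
    case (Star_refl \<sigma>)
    show ?case by (rule exI[of _ 0]) simp
  next
    case (Star_step \<sigma> \<sigma>' \<sigma>'')
    then show ?case by (blast intro: relpowp_Suc_I2)
  qed
next
  have "(big_step C ^^ n) \<sigma> \<sigma>' \<Longrightarrow> \<langle>Star C, \<sigma>\<rangle> \<rightarrow> \<sigma>'" for n
    \<comment> \<open>\<open>relpowp.simps(2)\<close> would split off the last iteration, while
      \<open>Star_step\<close> runs the body first; \<open>relpowp_Suc_E2\<close> splits off the
      first one, so the start state has to vary.\<close>
    by (induction n arbitrary: \<sigma>)
      (auto simp del: relpowp.simps(2) elim!: relpowp_Suc_E2
        intro: big_step.Star_refl big_step.Star_step)
  then show "\<exists>n. (big_step C ^^ n) \<sigma> \<sigma>' \<Longrightarrow> \<langle>Star C, \<sigma>\<rangle> \<rightarrow> \<sigma>'" by blast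
qed

text \<open>Both kinds of power split off the last iteration, and \<open>sem\<close> leaves the
  logical state fixed, so the induction step is one unfolding of \<open>sem\<close>.\<close>

lemma funpow_sem: "(sem C ^^ n) S = {\<phi>. \<exists>\<sigma>. (fst \<phi>, \<sigma>) \<in> S \<and> (big_step C ^^ n) \<sigma> (snd \<phi>)}"
  by (induction n) (auto simp: sem_def)

lemma sem_Star: "sem (Star C) S = (\<Union>n. (sem C ^^ n) S)"
  by (auto simp: funpow_sem sem_def[of "Star C"] big_step_Star_iff_relpowp)

theorem mainTheorem1:
  fixes P Q :: "('lvar, 'lval, 'pvar, 'pval) hassn"
    and C :: "('pvar, 'pval) cmd"
  assumes "\<turnstile> {P} C {Q}"
  shows "\<Turnstile> {P} C {Q}"
  using assms
proof (induction rule: hyper_derivable.induct)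
  case (Choice P C1 Q1 C2 Q2)
  then show ?case by (auto simp: hyper_valid_def sem_Choice otimes_def)
next
  case (Cons P P' Q' Q C)
  then show ?case by (auto simp: hyper_valid_def entails_def)
next
  case (Exist X P C Q)
  \<comment> \<open>The index chosen for \<open>S\<close> also serves for
    \<open>sem C S\<close>.\<close>
  then show ?case by (fastforce simp: hyper_valid_def)
next
  case (Iter I C)
  \<comment> \<open>The premise for \<open>n\<close> carries the invariant from one iterate to the
    next; the iterates are then the family \<open>f\<close> required by
    \<open>Otimes\<close>.\<close>
  have "I n ((sem C ^^ n) S)" if "I 0 S" for n S
    using that Iter.IH by (induction n) (auto simp: hyper_valid_def)
  then show ?case by (auto simp: hyper_valid_def sem_Star Otimes_def)
\<comment> \<open>For \<open>Assume\<close>, \<open>Assign\<close> and \<open>Havoc\<close> the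
  precondition is the postcondition evaluated at \<open>sem\<close> of the command.\<close>
qed (simp_all add: hyper_valid_def sem_Skip sem_Seq sem_Assume sem_Assign sem_Havoc)

end
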